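(* For each integer $m\ge1$ let $$P_m(x):=\sum_{j=1}^m t_j\,\pi^{2j}(1/4-x^2)^j,\qquad q_m:=\frac{\pi^2/4}{(2m+4)(2m+3)},$$ with $t_j$ as defined in the context. Then for all integers $m\ge 1$ and all $x\in(-1/2,1/2)$, $$P_m(x)<P_{m+1}(x)<\cos\pi x$$ and $$0<\cos\pi x-P_m(x)<\frac{\pi^{2m+2}(1/4-x^2)^{m+1}}{(2m+2)!}\,\frac{1}{1-q_m}.$$ Moreover, as $m\to\infty$, $$\frac{\pi^{2m+2}(1/4-x^2)^{m+1}}{(2m+2)!}\,\frac{1}{1-q_m}\ \sim\ \frac{\pi^{2m+2}(1/4-x^2)^{m+1}}{(2m+2)!}$$ uniformly in $x\in(-1/2,1/2)$ (i.e. the ratio of the two sides tends to $1$ uniformly in $x\in(-1/2,1/2)$).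
   Context: For integers $j\ge 1$, $$t_j:=\sum_{k=0}^\infty \frac{(-\pi^2/4)^k}{(2j+2k)!}\binom{j+k}{j}.$$ *)

theory Defs
  imports "HOL-Analysis.Analysis"
begin

definition t :: "nat \<Rightarrow> real" where
  "t j = (\<Sum>k. (- (pi\<^sup>2 / 4)) ^ k / fact (2 * j + 2 * k) * real ((j + k) choose j))"

definition P :: "nat \<Rightarrow> real \<Rightarrow> real" where
  "P m x = (\<Sum>j = 1..m. t j * pi ^ (2 * j) * (1 / 4 - x\<^sup>2) ^ j)"

definition q :: "nat \<Rightarrow> real" where
  "q m = (pi\<^sup>2 / 4) / ((2 * real m + 4) * (2 * real m + 3))"

end

theory Submission
  imports Defs
begin

text \<open>With \<open>y = pi\<^sup>2 (1/4 - x\<^sup>2)\<close> and \<open>a = pi\<^sup>2/4\<close> we have \<open>(pi x)\<^sup>2 = a - y\<close>, so the cosine series is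
  the sum of \<open>(y - a)\<^sup>n / (2n)!\<close>. Expanding binomially and collecting powers of \<open>y\<close> gives
  \<open>cos (pi x) = (\<Sum>j. t j * y\<^sup>j)\<close>, where \<open>t 0 = cos (pi/2) = 0\<close>. For \<open>j \<ge> 1\<close> the series defining \<open>t j\<close>
  is alternating with strictly decreasing terms, so \<open>0 < t j < 1 / (2j)!\<close>. Positivity gives
  the lower bounds, and comparing the tail with a geometric series of ratio \<open>q m\<close>
  gives the upper bound.\<close>

text \<open>Fubini for the binomially expanded series. In absolute value, row \<open>n\<close> of
  the expansion adds up to \<open>\<bar>c n\<bar> * (\<bar>u\<bar> + \<bar>v\<bar>) ^ n\<close>, so
  the hypothesis is absolute summability of the double family, and the powers of \<open>u\<close>
  may be collected first.\<close>

lemma sums_power_recentre: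
  fixes c :: "nat \<Rightarrow> real" and u v :: real
  assumes "summable (\<lambda>n. \<bar>c n\<bar> * (\<bar>u\<bar> + \<bar>v\<bar>) ^ n)"
  shows "(\<lambda>j. \<Sum>k. c (j + k) * real ((j + k) choose j) * v ^ k * u ^ j) sums (\<Sum>n. c n * (u + v) ^ n)"
proof -
  define f where "f = (\<lambda>(n, j). c n * (real (n choose j) * u ^ j * v ^ (n - j)))"
  define g where "g = (\<lambda>(j, k). c (j + k) * real ((j + k) choose j) * v ^ k * u ^ j)"
  define D where "D = (SIGMA n:(UNIV :: nat set). {..n})"
  have norm_inner: "(\<Sum>j\<le>n. norm (f (n, j))) = \<bar>c n\<bar> * (\<bar>u\<bar> + \<bar>v\<bar>) ^ n" for n
    by (simp add: f_def binomial_ring abs_mult power_abs sum_distrib_left)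
  have inner: "(\<Sum>j\<le>n. f (n, j)) = c n * (u + v) ^ n" for n
    by (simp add: f_def binomial_ring sum_distrib_left)
  have "(\<lambda>z. norm (f z)) summable_on D"
    unfolding D_def
  proof (rule summable_on_SigmaI)
    show "((\<lambda>j. norm (f (n, j))) has_sum \<bar>c n\<bar> * (\<bar>u\<bar> + \<bar>v\<bar>) ^ n) {..n}" for n
      using has_sum_finite[of "{..n}" "\<lambda>j. norm (f (n, j))"] unfolding norm_inner by simp
    show "(\<lambda>n. \<bar>c n\<bar> * (\<bar>u\<bar> + \<bar>v\<bar>) ^ n) summable_on UNIV"
      using assms by (intro norm_summable_imp_summable_on) (simp add: abs_mult power_abs)
  qed auto
  then have sumf: "f summable_on D"
    by (rule abs_summable_summable)
  then obtain S where S: "(f has_sum S) D"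
    by (auto simp: summable_on_def)
  have "((\<lambda>n. c n * (u + v) ^ n) has_sum S) UNIV"
  proof (rule has_sum_SigmaD)
    show "(f has_sum S) (SIGMA n:UNIV. {..n})"
      using S by (simp add: D_def)
    show "((\<lambda>j. f (n, j)) has_sum c n * (u + v) ^ n) {..n}" for n
      using has_sum_finite[of "{..n}" "\<lambda>j. f (n, j)"] by (simp add: inner)
  qed
  then have S_eq: "S = (\<Sum>n. c n * (u + v) ^ n)"
    by (metis has_sum_imp_sums sums_unique)
  \<comment> \<open>The substitution n = j + k turns the triangle j \<le> n into the full quadrant
    of pairs (j, k).\<close>
  have "(g has_sum S) (UNIV \<times> UNIV)"
    using S
    by (rule has_sum_reindex_bij_witness[of _ "\<lambda>(j, k). (j + k, j)" "\<lambda>(n, j). (j, n - j)", THEN iffD1, rotated -1])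
       (auto simp: f_def g_def D_def algebra_simps)
  then have G: "(g has_sum S) (SIGMA j:UNIV. UNIV)"
    by simp
  have inner_g: "((\<lambda>k. g (j, k)) has_sum (\<Sum>k. g (j, k))) UNIV" for j
  proof -
    have "(\<lambda>k. g (j, k)) summable_on UNIV"
      using G by (intro summable_on_SigmaD1[where f="\<lambda>j k. g (j, k)" and A=UNIV and B="\<lambda>_. UNIV"])
        (auto simp: summable_on_def)
    then show ?thesis
      by (metis has_sum_imp_sums has_sum_infsum sums_unique)
  qed
  have "((\<lambda>j. \<Sum>k. g (j, k)) has_sum S) UNIV"
    using G inner_g by (rule has_sum_SigmaD)
  then show ?thesis
    using S_eq by (simp add: has_sum_imp_sums g_def)
qed

text \<open>The series of \<open>t j\<close> with its signs removed, the form to which the Leibniz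
  criterion applies.\<close>

definition t_term :: "nat \<Rightarrow> nat \<Rightarrow> real" where
  "t_term j k = (pi\<^sup>2 / 4) ^ k / fact (2 * j + 2 * k) * real ((j + k) choose j)"

lemma t_eq_alternating: "t j = (\<Sum>k. (- 1) ^ k * t_term j k)"
proof -
  have "(- (pi\<^sup>2 / 4)) ^ k = (- 1) ^ k * (pi\<^sup>2 / 4) ^ k" for k
    by (subst power_mult_distrib[symmetric]) simp
  then show ?thesis
    by (simp add: t_def t_term_def mult_ac)
qed

lemma pi_sq_quarter_less: "pi\<^sup>2 / 4 < 4"
  using power_strict_mono[OF pi_less_4, of 2] by simp

lemma t_term_pos: "0 < t_term j k"
  by (simp add: t_term_def)

lemma t_term_Suc:
  "t_term j (Suc k) = (pi\<^sup>2 / 4) / (2 * (real k + 1) * (2 * real j + 2 * real k + 1)) * t_term j k"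
proof -
  \<comment> \<open>Absorption identity for the lower index k, carried over to j by the symmetry of
    binomial coefficients.\<close>
  have "Suc k * (Suc (j + k) choose j) = Suc (j + k) * ((j + k) choose j)"
    using Suc_times_binomial_eq[of "j + k" k] binomial_symmetric[of j "j + k"]
      binomial_symmetric[of j "Suc (j + k)"]
    by (simp del: binomial_Suc_Suc mult_Suc add: mult.commute)
  then have "real (Suc k * (Suc (j + k) choose j)) = real (Suc (j + k) * ((j + k) choose j))"
    by (rule arg_cong)
  then have binom: "real (Suc (j + k) choose j) = (real j + real k + 1) / (real k + 1) * real ((j + k) choose j)"
    by (simp add: field_simps del: binomial_Suc_Suc)
  have fact_eq: "(fact (2 * j + 2 * Suc k) :: real)
      = 2 * (real j + real k + 1) * (2 * real j + 2 * real k + 1) * fact (2 * j + 2 * k)"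
    by (simp add: algebra_simps)
  \<comment> \<open>Here \<open>n\<close> is j + k + 1, the factor shared by the binomial and the
    factorial quotients. Division by 0 yields 0 on both sides, so only \<open>n\<close> has to be
    nonzero.\<close>
  have cancellation: "a ^ Suc k / (2 * n * d * F) * (n / l * C) = a / (2 * l * d) * (a ^ k / F * C)"
    if "n \<noteq> 0" for a n d F l C :: real
    using that by (simp add: field_simps)
  show ?thesis
    unfolding t_term_def add_Suc_right binom fact_eq by (rule cancellation) linarith
qed

text \<open>For j \<ge> 1 the quotient in \<open>t_term_Suc\<close> has denominator at least 6 and
  numerator below 4. For j = 0 the first quotient is pi^2/8 > 1, so that case is treated
  separately.\<close>

lemma t_term_Suc_le:
  assumes "1 \<le> j"
  shows "t_term j (Suc k) \<le> 2 / 3 * t_term j k"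
proof -
  have "(1 * 3 :: real) \<le> (real k + 1) * (2 * real j + 2 * real k + 1)"
    using assms by (intro mult_mono) auto
  then have "6 \<le> 2 * (real k + 1) * (2 * real j + 2 * real k + 1)"
    by linarith
  then have "(pi\<^sup>2 / 4) / (2 * (real k + 1) * (2 * real j + 2 * real k + 1)) \<le> 4 / 6"
    using pi_sq_quarter_less by (intro frac_le) linarith+
  then show ?thesis
    unfolding t_term_Suc using t_term_pos[of j k] by (intro mult_right_mono) auto
qed

lemma summable_t_term:
  assumes "1 \<le> j"
  shows "summable (t_term j)"
  using t_term_Suc_le[OF assms] t_term_pos[of j]
  by (intro summable_ratio_test[of "2 / 3" 0]) (auto simp: abs_of_pos)

lemma t_bounds:
  assumes "1 \<le> j"
  shows "0 < t j" and "t j < 1 / fact (2 * j)"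
proof -
  have lt: "t_term j (Suc k) < t_term j k" for k
    using t_term_Suc_le[OF assms, of k] t_term_pos[of j k] by linarith
  note L = summable_Leibniz'[OF summable_LIMSEQ_zero[OF summable_t_term[OF assms]]
      less_imp_le[OF t_term_pos] less_imp_le[OF lt]]
  have "t_term j 0 - t_term j 1 \<le> t j"
    using L(2)[of 1] by (simp add: t_eq_alternating numeral_2_eq_2)
  then show "0 < t j"
    using lt[of 0] by simp
  \<comment> \<open>One term would bound \<open>t j\<close> only weakly; with three terms the strict
    decrease from \<open>t_term j 1\<close> to \<open>t_term j 2\<close> makes the bound
    strict.\<close>
  have "t j \<le> t_term j 0 - t_term j 1 + t_term j 2"
    using L(4)[of 1] by (simp add: t_eq_alternating numeral_2_eq_2)
  then have "t j < t_term j 0"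
    using lt[of 1] by (simp add: numeral_2_eq_2)
  then show "t j < 1 / fact (2 * j)"
    by (simp add: t_term_def)
qed

text \<open>This is the cosine series at pi/2.\<close>

lemma t_0_series_sums: "(\<lambda>k. (- (pi\<^sup>2 / 4)) ^ k / fact (2 * k)) sums 0"
proof -
  have "(- (pi\<^sup>2 / 4)) ^ k / fact (2 * k) = (- 1) ^ k / fact (2 * k) * (pi / 2) ^ (2 * k)" for k
    unfolding power_mult
    by (simp add: power_divide power_minus[of "pi\<^sup>2 / 4"])
  then show ?thesis
    using cos_paired[of "pi / 2"] by simp
qed

lemma t_0: "t 0 = 0"
  using sums_unique[OF t_0_series_sums] by (simp add: t_def)

lemma summable_t_series: "summable (\<lambda>k. (- (pi\<^sup>2 / 4)) ^ k / fact (2 * j + 2 * k) * real ((j + k) choose j))"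
proof (cases "j = 0")
  case True
  then show ?thesis
    using sums_summable[OF t_0_series_sums] by simp
next
  case False
  then have "summable (t_term j)"
    by (simp add: summable_t_term)
  then show ?thesis
    by (rule summable_comparison_test'[of _ 0]) (simp add: t_term_def abs_mult power_abs)
qed

lemma cos_sums_t:
  "(\<lambda>j. t j * (pi\<^sup>2 * (1 / 4 - x\<^sup>2)) ^ j) sums cos (pi * x)"
proof -
  define y where "y = pi\<^sup>2 * (1 / 4 - x\<^sup>2)"
  have "summable (\<lambda>n. \<bar>1 / fact (2 * n)\<bar> * (\<bar>y\<bar> + \<bar>- (pi\<^sup>2 / 4)\<bar>) ^ n)"
  \<comment> \<open>Since n! \<le> (2n)!, the exponential series dominates.\<close>
  proof (rule summable_comparison_test'[of _ 0])
    show "summable (\<lambda>n. inverse (fact n) * (\<bar>y\<bar> + pi\<^sup>2 / 4) ^ n)"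
      by (rule summable_exp)
    show "norm (\<bar>1 / fact (2 * n)\<bar> * (\<bar>y\<bar> + \<bar>- (pi\<^sup>2 / 4)\<bar>) ^ n)
        \<le> inverse (fact n) * (\<bar>y\<bar> + pi\<^sup>2 / 4) ^ n" for n
      using fact_mono[of n "2 * n", where 'a=real]
      by (simp add: abs_mult power_abs divide_simps mult_left_mono)
  qed
  from sums_power_recentre[OF this]
  have "(\<lambda>j. \<Sum>k. 1 / fact (2 * (j + k)) * real ((j + k) choose j) * (- (pi\<^sup>2 / 4)) ^ k * y ^ j)
      sums (\<Sum>n. 1 / fact (2 * n) * (y + - (pi\<^sup>2 / 4)) ^ n)" .
  moreover have "(\<Sum>k. 1 / fact (2 * (j + k)) * real ((j + k) choose j) * (- (pi\<^sup>2 / 4)) ^ k * y ^ j)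
      = t j * y ^ j" for j
    unfolding t_def by (subst suminf_mult2[OF summable_t_series]) (simp add: mult_ac distrib_left)
  moreover have "1 / fact (2 * n) * (y + - (pi\<^sup>2 / 4)) ^ n = (- 1) ^ n / fact (2 * n) * (pi * x) ^ (2 * n)" for n
  proof -
    have "y + - (pi\<^sup>2 / 4) = - ((pi * x)\<^sup>2)"
      by (simp add: y_def algebra_simps power_mult_distrib)
    then show ?thesis
      by (simp add: power_minus[of "(pi * x)\<^sup>2"] power_mult)
  qed
  ultimately show ?thesis
    using sums_unique[OF cos_paired[of "pi * x"]] by (simp add: y_def)
qed

text \<open>Because \<open>t 0 = 0\<close>, the term j = 0 can be included; \<open>P m x\<close> is
  then an initial segment of the series in \<open>cos_sums_t\<close>, and the error is its tail from
  \<open>Suc m\<close> on.\<close>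

lemma P_eq_partial_sum: "P m x = (\<Sum>j<Suc m. t j * (pi\<^sup>2 * (1 / 4 - x\<^sup>2)) ^ j)"
proof -
  have "{..<Suc m} = insert 0 {1..m}"
    by auto
  then show ?thesis
    by (simp add: P_def t_0 power_mult_distrib power_mult mult.assoc)
qed

lemma q_nonneg: "0 \<le> q m"
  by (simp add: q_def)

lemma q_less_1: "q m < 1"
proof -
  have "(3 * 3 :: real) \<le> (2 * real m + 4) * (2 * real m + 3)"
    by (intro mult_mono) auto
  then have "pi\<^sup>2 / 4 < (2 * real m + 4) * (2 * real m + 3)"
    using pi_sq_quarter_less by linarith
  then show ?thesis
    unfolding q_def by (subst divide_less_eq_1) (auto intro: add_nonneg_pos)
qed

lemma q_tendsto_0: "q \<longlonglongrightarrow> 0"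
  unfolding q_def
  by (intro tendsto_divide_0[OF tendsto_const] filterlim_at_top_imp_at_infinity filterlim_at_top_mult_at_top)
    (rule filterlim_at_top_mono[OF filterlim_real_sequentially], simp)+

text \<open>Each step in i multiplies the left side by y / ((2i+2m+4)(2i+2m+3)). This factor is
  largest at i = 0 and y = pi^2/4, where it equals \<open>q m\<close>.\<close>

lemma power_div_fact_le:
  assumes "0 \<le> y" "y \<le> pi\<^sup>2 / 4"
  shows "y ^ i / fact (2 * (i + Suc m)) \<le> q m ^ i / fact (2 * m + 2)"
proof (induction i)
  case (Suc i)
  define d where "d = (2 * real i + 2 * real m + 4) * (2 * real i + 2 * real m + 3)"
  have "(fact (2 * (Suc i + Suc m)) :: real) = d * fact (2 * (i + Suc m))"
    by (simp add: d_def algebra_simps)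
  then have "y ^ Suc i / fact (2 * (Suc i + Suc m)) = (y / d) * (y ^ i / fact (2 * (i + Suc m)))"
    by simp
  also have "\<dots> \<le> q m * (q m ^ i / fact (2 * m + 2))"
  proof (rule mult_mono[OF _ Suc])
    show "y / d \<le> q m"
      unfolding q_def d_def using assms by (intro frac_le mult_mono mult_pos_pos) auto
  qed (use assms q_nonneg in auto)
  finally show ?case
    by simp
qed simp

lemma quarter_minus_sq_pos:
  assumes "x \<in> {-1/2<..<1/2::real}"
  shows "0 < 1 / 4 - x\<^sup>2"
proof -
  have "0 < (1 / 2 - x) * (1 / 2 + x)"
    using assms by (intro mult_pos_pos) auto
  then show ?thesis
    by (simp add: algebra_simps power2_eq_square)
qed

lemma P_cos_bounds:
  assumes x: "x \<in> {-1/2<..<1/2::real}"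
  shows "P m x < P (m + 1) x" "P m x < cos (pi * x)"
    and "cos (pi * x) - P m x
      < pi ^ (2 * m + 2) * (1 / 4 - x\<^sup>2) ^ (m + 1) / fact (2 * m + 2) * (1 / (1 - q m))"
proof -
  define y where "y = pi\<^sup>2 * (1 / 4 - x\<^sup>2)"
  have y: "0 < y" "y \<le> pi\<^sup>2 / 4"
    using quarter_minus_sq_pos[OF x] by (auto simp: y_def algebra_simps)
  show "P m x < P (m + 1) x"
    using y t_bounds(1)[of "Suc m"] by (simp add: P_eq_partial_sum flip: y_def)
  have tail: "(\<lambda>i. t (i + Suc m) * y ^ (i + Suc m)) sums (cos (pi * x) - P m x)"
    using sums_split_initial_segment[OF cos_sums_t, of "Suc m" x] by (simp only: P_eq_partial_sum y_def)
  have pos: "0 < t (i + Suc m) * y ^ (i + Suc m)" for i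
    using y t_bounds(1)[of "i + Suc m"] by simp
  show "P m x < cos (pi * x)"
    using suminf_pos[OF sums_summable[OF tail] pos] sums_unique[OF tail] by simp
  \<comment> \<open>\<open>K\<close> bounds the first omitted term; the whole tail is compared with
    the geometric series that starts at \<open>K\<close> and has ratio \<open>q m\<close>.\<close>
  define K where "K = y ^ (m + 1) / fact (2 * m + 2)"
  have geo: "(\<lambda>i. K * q m ^ i) sums (K * (1 / (1 - q m)))"
    using q_nonneg[of m] q_less_1[of m] by (intro sums_mult geometric_sums) simp
  have less: "t (i + Suc m) * y ^ (i + Suc m) < K * q m ^ i" for i
  proof -
    have "t (i + Suc m) * y ^ (i + Suc m) < 1 / fact (2 * (i + Suc m)) * y ^ (i + Suc m)"
      using y t_bounds(2)[of "i + Suc m"] by (intro mult_strict_right_mono) simp_all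
    also have "\<dots> = y ^ Suc m * (y ^ i / fact (2 * (i + Suc m)))"
      by (simp add: power_add)
    also have "\<dots> \<le> y ^ Suc m * (q m ^ i / fact (2 * m + 2))"
      using y power_div_fact_le[of y i m] by (intro mult_left_mono) auto
    finally show ?thesis
      by (simp add: K_def)
  qed
  \<comment> \<open>Summing the positive differences keeps the inequality strict in the
    limit.\<close>
  have "0 < (\<Sum>i. K * q m ^ i - t (i + Suc m) * y ^ (i + Suc m))"
    using less by (intro suminf_pos sums_summable[OF sums_diff[OF geo tail]]) simp
  then have "cos (pi * x) - P m x < K * (1 / (1 - q m))"
    using sums_unique[OF sums_diff[OF geo tail]] by simp
  moreover have "y ^ (m + 1) = pi ^ (2 * m + 2) * (1 / 4 - x\<^sup>2) ^ (m + 1)"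
    unfolding y_def power_mult_distrib power_mult[symmetric] by simp
  ultimately show "cos (pi * x) - P m x
      < pi ^ (2 * m + 2) * (1 / 4 - x\<^sup>2) ^ (m + 1) / fact (2 * m + 2) * (1 / (1 - q m))"
    by (simp only: K_def)
qed

theorem corollary1p2:
  shows "(\<forall>m::nat. 1 \<le> m \<longrightarrow> (\<forall>x::real. x \<in> {-1/2<..<1/2} \<longrightarrow>
            P m x < P (m + 1) x \<and> P (m + 1) x < cos (pi * x) \<and>
            0 < cos (pi * x) - P m x \<and>
            cos (pi * x) - P m x
              < pi ^ (2 * m + 2) * (1 / 4 - x\<^sup>2) ^ (m + 1) / fact (2 * m + 2) * (1 / (1 - q m))))
       \<and> uniform_limit {-1/2<..<1/2}
            (\<lambda>(m::nat) (x::real).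
               (pi ^ (2 * m + 2) * (1 / 4 - x\<^sup>2) ^ (m + 1) / fact (2 * m + 2) * (1 / (1 - q m)))
               / (pi ^ (2 * m + 2) * (1 / 4 - x\<^sup>2) ^ (m + 1) / fact (2 * m + 2)))
            (\<lambda>x. 1) sequentially"
    (is "_ \<and> uniform_limit ?I ?r _ _")
proof
  \<comment> \<open>On the open interval the common factor is nonzero and cancels. The ratio no
    longer depends on x, so its convergence is automatically uniform.\<close>
  have ratio: "?r m x = 1 / (1 - q m)" if "x \<in> ?I" for m x
    using quarter_minus_sq_pos[OF that] by simp
  have "(\<lambda>m. 1 / (1 - q m)) \<longlonglongrightarrow> 1 / (1 - 0)"
    by (intro tendsto_intros q_tendsto_0) simp
  then have "\<forall>\<^sub>F m in sequentially. dist (1 / (1 - q m)) 1 < e" if "0 < e" for e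
    using tendstoD[OF _ that] by simp
  then show "uniform_limit ?I ?r (\<lambda>x. 1) sequentially"
    by (intro uniform_limitI) (use ratio in \<open>force elim!: eventually_mono\<close>)
  show "\<forall>m::nat. 1 \<le> m \<longrightarrow> (\<forall>x::real. x \<in> ?I \<longrightarrow>
            P m x < P (m + 1) x \<and> P (m + 1) x < cos (pi * x) \<and>
            0 < cos (pi * x) - P m x \<and>
            cos (pi * x) - P m x
              < pi ^ (2 * m + 2) * (1 / 4 - x\<^sup>2) ^ (m + 1) / fact (2 * m + 2) * (1 / (1 - q m)))"
    \<comment> \<open>Rewriting the positive difference as \<open>P m x < cos (pi * x)\<close> lets
      the same bound serve at m and at m + 1.\<close>
    unfolding diff_gt_0_iff_gt by (intro allI impI conjI P_cos_bounds)
qed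

end
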